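(* Let $Y$ be a real random variable with Lebesgue density $f : \mathbb{R} \to [0,\infty)$, and let $g(x) := \sum_{z \in \mathbb{Z}} f(z+x)$ for $x \in \mathbb{R}$. Let $k \ge 1$ be an integer, and suppose that $f$ is $k$ times absolutely continuous such that $\mathrm{TV}(f^{(k)}) < \infty$ for some version of $f^{(k)}$. Then $g$ is Lipschitz-continuous on $\mathbb{R}$. Precisely, for $x, y \in \mathbb{R}$ with $|x-y| \le 1$, $$|g(x) - g(y)| \le |x-y|(1-|x-y|) \frac{\mathrm{TV}(f^{(k)})}{2 \cdot 6^{k-1}} \le \frac{\mathrm{TV}(f^{(k)})}{8 \cdot 6^{k-1}} .$$
   Context: For a function $h : \mathbb{R} \to \mathbb{R}$, the total variation is $$\mathrm{TV}(h) := \sup\Bigl\{ \sum_{i=1}^m |h(t_i) - h(t_{i-1})| : m \in \mathbb{N};\ t_0 < t_1 < \cdots < t_m \text{ in } \mathbb{R} \Bigr\}.$$ A function $h$ on the real line is called $k \ge 1$ times absolutely continuous if $h \in \mathcal{C}^{k-1}(\mathbb{R})$ and its derivative $h^{(k-1)}$ is (locally) absolutely continuous; $h^{(k)}$ then denotes some version of the derivative of $h^{(k-1)}$ in $L^1_{\rm loc}(\mathbb{R})$ (i.e. a function $\mathbb{R}\to\mathbb{R}$ equal almost everywhere to that derivative). In the claim, $\mathrm{TV}(f^{(k)})$ is the total variation of the version of $f^{(k)}$ that is assumed to have finite total variation. A priori $g$ takes values in $[0,\infty]$; the conclusion includes that $g$ is finite everywhere. *)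

theory Defs
  imports "HOL-Probability.Probability"
begin

definition total_variation :: "(real \<Rightarrow> real) \<Rightarrow> ennreal" where
  "total_variation h =
     Sup {(\<Sum>i = 1..m. ennreal \<bar>h (t i) - h (t (i - 1))\<bar>) | (m :: nat) (t :: nat \<Rightarrow> real).
            strict_mono_on {0..m} t}"

text \<open>
  The usual \<open>\<epsilon>\<close>-\<open>\<delta>\<close> definition. A finite family of non-overlapping compact intervals
  \<open>[u, v]\<close> is a division \<open>\<D>\<close> of its own union, with \<open>u = Inf K\<close> and \<open>v = Sup K\<close> for
  \<open>K \<in> \<D>\<close>. Degenerate intervals are allowed but contribute nothing to either sum.
\<close>

definition abs_continuous_on :: "real set \<Rightarrow> (real \<Rightarrow> real) \<Rightarrow> bool" where
  "abs_continuous_on S h \<longleftrightarrow>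
     (\<forall>\<epsilon>>0. \<exists>\<delta>>0. \<forall>\<D>. \<D> division_of \<Union>\<D> \<and> \<Union>\<D> \<subseteq> S \<and> (\<Sum>K\<in>\<D>. Sup K - Inf K) < \<delta> \<longrightarrow>
        (\<Sum>K\<in>\<D>. \<bar>h (Sup K) - h (Inf K)\<bar>) < \<epsilon>)"

definition locally_abs_continuous :: "(real \<Rightarrow> real) \<Rightarrow> bool" where
  "locally_abs_continuous h \<longleftrightarrow> (\<forall>a b. abs_continuous_on {a..b} h)"

definition C_class :: "nat \<Rightarrow> (real \<Rightarrow> real) \<Rightarrow> bool" where
  "C_class n h \<longleftrightarrow>
     (\<forall>j<n. \<forall>x. (deriv ^^ j) h field_differentiable (at x)) \<and> continuous_on UNIV ((deriv ^^ n) h)"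

definition times_abs_continuous :: "nat \<Rightarrow> (real \<Rightarrow> real) \<Rightarrow> bool" where
  "times_abs_continuous k h \<longleftrightarrow>
     1 \<le> k \<and> C_class (k - 1) h \<and> locally_abs_continuous ((deriv ^^ (k - 1)) h)"

text \<open>
  \<open>v\<close> is a version of the \<open>k\<close>-th derivative of a \<open>k\<close> times absolutely continuous function \<open>h\<close>.
  Neither measurability nor local integrability of \<open>v\<close> is required: the almost everywhere
  derivative of a locally absolutely continuous function is locally integrable anyway.
\<close>

definition deriv_version :: "nat \<Rightarrow> (real \<Rightarrow> real) \<Rightarrow> (real \<Rightarrow> real) \<Rightarrow> bool" where
  "deriv_version k h v \<longleftrightarrow>
     (AE x in lebesgue. ((deriv ^^ (k - 1)) h has_real_derivative v x) (at x))"

definition periodization :: "(real \<Rightarrow> real) \<Rightarrow> real \<Rightarrow> ennreal" where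
  "periodization f x = (\<Sum>\<^sub>\<infinity>z::int. ennreal (f (of_int z + x)))"

end

theory Submission
  imports Defs
begin

text \<open>
  Replace \<open>g\<close> by the window sums \<open>\<Sum>|z| \<le> N. f (z + x)\<close>, and likewise for the derivatives of \<open>f\<close>. Over
  a unit step a window sum changes only by its two boundary terms. These vanish as \<open>N \<rightarrow> \<infinity>\<close>: \<open>f\<^sup>(\<^sup>k\<^sup>)\<close> and
  the distribution function of \<open>Y\<close> have bounded variation, hence oscillate slowly at infinity, and this forces
  all intermediate derivatives to vanish there. For \<open>f\<^sup>(\<^sup>k\<^sup>)\<close>, the increments from \<open>x\<close> to \<open>y\<close> and from \<open>y\<close> to
  \<open>x + 1\<close> nearly cancel and their absolute values add up to at most \<open>TV\<close>, so each is at most about \<open>TV / 2\<close>.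
  If increments over distance \<open>t\<close> are at most \<open>c t\<close> at one level, then one integration below they are at most
  \<open>d (1 - d) \<integral>\<^sub>0\<^sup>1 c\<close> over distance \<open>d\<close>; the first step contributes \<open>TV / 2\<close>, every further one the factor
  \<open>\<integral>\<^sub>0\<^sup>1 t (1 - t) dt = 1 / 6\<close>.
\<close>

section \<open>Primitives, slow oscillation and decay at infinity\<close>

text \<open>Interval integrals replace pointwise derivatives because \<open>fk\<close> is a
  derivative only almost everywhere. The relation is also stable under translations, differences and
  finite sums.\<close>

definition primitive :: "(real \<Rightarrow> real) \<Rightarrow> (real \<Rightarrow> real) \<Rightarrow> bool" where
  "primitive h H \<longleftrightarrow> (\<forall>a b. a \<le> b \<longrightarrow> (h has_integral H b - H a) {a..b})"

definition slowly_oscillating :: "(real \<Rightarrow> real) \<Rightarrow> bool" where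
  "slowly_oscillating h \<longleftrightarrow>
     (\<forall>e>0. \<exists>X. \<forall>x t. X \<le> \<bar>x\<bar> \<longrightarrow> 0 \<le> t \<longrightarrow> t \<le> 1 \<longrightarrow> \<bar>h (x + t) - h x\<bar> \<le> e)"

definition vanishing :: "(real \<Rightarrow> real) \<Rightarrow> bool" where
  "vanishing h \<longleftrightarrow> (\<forall>e>0. \<exists>X. \<forall>x. X \<le> \<bar>x\<bar> \<longrightarrow> \<bar>h x\<bar> \<le> e)"

lemma vanishing_imp_slowly_oscillating:
  assumes "vanishing h" shows "slowly_oscillating h"
  unfolding slowly_oscillating_def
proof (intro allI impI)
  fix e :: real assume "e > 0"
  then obtain X where X: "\<And>x. X \<le> \<bar>x\<bar> \<Longrightarrow> \<bar>h x\<bar> \<le> e/2"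
    using assms unfolding vanishing_def by (meson half_gt_zero)
  \<comment> \<open>The margin 1 keeps \<open>x + t\<close> beyond \<open>X\<close> when
    \<open>x\<close> is negative.\<close>
  have "\<bar>h (x + t) - h x\<bar> \<le> e" if "X + 1 \<le> \<bar>x\<bar>" "0 \<le> t" "t \<le> 1" for x t
    using X[of x] X[of "x + t"] that by linarith
  then show "\<exists>X. \<forall>x t. X \<le> \<bar>x\<bar> \<longrightarrow> 0 \<le> t \<longrightarrow> t \<le> 1 \<longrightarrow> \<bar>h (x + t) - h x\<bar> \<le> e" by blast
qed

lemma vanishing_cong_diff:
  assumes "vanishing (\<lambda>x. a x - b x)" "vanishing a" shows "vanishing b"
  unfolding vanishing_def
proof (intro allI impI)
  fix e :: real assume "e > 0"
  then obtain X Y where X: "\<And>x. X \<le> \<bar>x\<bar> \<Longrightarrow> \<bar>a x - b x\<bar> \<le> e/2" and Y: "\<And>x. Y \<le> \<bar>x\<bar> \<Longrightarrow> \<bar>a x\<bar> \<le> e/2"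
    using assms unfolding vanishing_def by (meson half_gt_zero)
  have "\<bar>b x\<bar> \<le> e" if "max X Y \<le> \<bar>x\<bar>" for x
    using X[of x] Y[of x] that by linarith
  then show "\<exists>X. \<forall>x. X \<le> \<bar>x\<bar> \<longrightarrow> \<bar>b x\<bar> \<le> e" by blast
qed

lemma slowly_oscillating_cong_diff:
  assumes "vanishing (\<lambda>x. a x - b x)" "slowly_oscillating a" shows "slowly_oscillating b"
  unfolding slowly_oscillating_def
proof (intro allI impI)
  fix e :: real assume "e > 0"
  then have "e/3 > 0" by simp
  then obtain X Y where X: "\<And>x. X \<le> \<bar>x\<bar> \<Longrightarrow> \<bar>a x - b x\<bar> \<le> e/3"
    and Y: "\<And>x t. Y \<le> \<bar>x\<bar> \<Longrightarrow> 0 \<le> t \<Longrightarrow> t \<le> 1 \<Longrightarrow> \<bar>a (x+t) - a x\<bar> \<le> e/3"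
    using assms unfolding vanishing_def slowly_oscillating_def by meson
  have "\<bar>b (x+t) - b x\<bar> \<le> e" if "max X Y + 1 \<le> \<bar>x\<bar>" "0 \<le> t" "t \<le> 1" for x t
  proof -
    have "\<bar>a x - b x\<bar> \<le> e/3" "\<bar>a (x+t) - b (x+t)\<bar> \<le> e/3" "\<bar>a (x+t) - a x\<bar> \<le> e/3"
      by (rule X Y; use that in linarith)+
    then show ?thesis by linarith
  qed
  then show "\<exists>X. \<forall>x t. X \<le> \<bar>x\<bar> \<longrightarrow> 0 \<le> t \<longrightarrow> t \<le> 1 \<longrightarrow> \<bar>b (x + t) - b x\<bar> \<le> e" by blast
qed

lemma slowly_oscillating_difference:
  assumes "slowly_oscillating h" shows "vanishing (\<lambda>x. h (x + 1) - h x)"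
  unfolding vanishing_def
  by (metis assms slowly_oscillating_def order_refl zero_le_one)

lemma primitive_translate:
  assumes "primitive h H" shows "primitive (\<lambda>x. h (c + x)) (\<lambda>x. H (c + x))"
  using assms has_integral_shift_Icc_real[of h c]
  unfolding primitive_def o_def by (simp add: add.commute)

lemma primitive_diff:
  assumes "primitive h H" "primitive k K" shows "primitive (\<lambda>x. h x - k x) (\<lambda>x. H x - K x)"
  unfolding primitive_def
proof (intro allI impI)
  fix a b :: real assume "a \<le> b"
  then have "((\<lambda>x. h x - k x) has_integral (H b - H a) - (K b - K a)) {a..b}"
    using assms by (intro has_integral_diff) (auto simp: primitive_def)
  then show "((\<lambda>x. h x - k x) has_integral (H b - K b) - (H a - K a)) {a..b}"
    by (simp add: algebra_simps)
qed

lemma primitive_sum: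
  assumes "finite A" "\<And>i. i \<in> A \<Longrightarrow> primitive (h i) (H i)"
  shows "primitive (\<lambda>x. \<Sum>i\<in>A. h i x) (\<lambda>x. \<Sum>i\<in>A. H i x)"
  using assms unfolding primitive_def
  by (auto simp flip: sum_subtractf intro!: has_integral_sum)

text \<open>For large \<bar>x\<bar>, \<open>h\<close> stays within \<open>e\<close> of
  \<open>h x\<close> on [x, x + 1], and so does its mean \<open>H (x + 1) - H x\<close>. This
  compares a member of a chain of primitives with the unit difference of the one below.\<close>

lemma slowly_oscillating_unit_mean:
  assumes p: "primitive h H" and so: "slowly_oscillating h"
  shows "vanishing (\<lambda>x. h x - (H (x + 1) - H x))"
  unfolding vanishing_def
proof (intro allI impI)
  fix e :: real assume "e > 0"
  then obtain X where X: "\<And>x t. X \<le> \<bar>x\<bar> \<Longrightarrow> 0 \<le> t \<Longrightarrow> t \<le> 1 \<Longrightarrow> \<bar>h (x+t) - h x\<bar> \<le> e"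
    using so unfolding slowly_oscillating_def by meson
  have "\<bar>h x - (H (x + 1) - H x)\<bar> \<le> e" if x: "X \<le> \<bar>x\<bar>" for x
  proof -
    have i: "(h has_integral H (x+1) - H x) {x..x+1}" using p by (simp add: primitive_def)
    have b: "h x - e \<le> h y" "h y \<le> h x + e" if "y \<in> {x..x+1}" for y
      using X[of x "y - x"] x that by (auto simp: abs_le_iff)
    have "h x - e \<le> H (x+1) - H x"
      using has_integral_le[OF has_integral_const_real[of "h x - e" x "x+1"] i] b by simp
    moreover have "H (x+1) - H x \<le> h x + e"
      using has_integral_le[OF i has_integral_const_real[of "h x + e" x "x+1"]] b by simp
    ultimately show ?thesis by linarith
  qed
  then show "\<exists>X. \<forall>x. X \<le> \<bar>x\<bar> \<longrightarrow> \<bar>h x - (H (x + 1) - H x)\<bar> \<le> e" by blast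
qed

text \<open>The induction hypothesis is used twice: for the unit differences of the first \<open>m + 1\<close> members of the
  chain, which makes \<open>F (m + 1)\<close> vanish, so that \<open>F m\<close> oscillates slowly, and then for the shortened chain.\<close>

lemma vanishing_primitive_chain:
  assumes "\<And>i. i < m \<Longrightarrow> primitive (F (Suc i)) (F i)"
    and "slowly_oscillating (F 0)" "slowly_oscillating (F m)"
    and "1 \<le> i" "i \<le> m"
  shows "vanishing (F i)"
  using assms
proof (induction m arbitrary: F i)
  case 0
  then show ?case by simp
next
  case (Suc m)
  define D where "D j x = F j (x + 1) - F j x" for j x
  have D: "primitive (D (Suc j)) (D j)" if "j < m" for j
    using primitive_diff[OF primitive_translate[of _ _ 1] , of "F (Suc j)" "F j" "F (Suc j)" "F j"]
      Suc.prems(1)[of j] that by (simp add: D_def[abs_def] add.commute)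
  have D0: "vanishing (D 0)"
    using slowly_oscillating_difference[OF Suc.prems(2)] by (simp add: D_def[abs_def])
  \<comment> \<open>\<open>F (Suc m)\<close> and \<open>D m\<close> differ by a vanishing function,
    so slow oscillation passes from \<open>F (Suc m)\<close> to \<open>D m\<close>, and decay passes
    back.\<close>
  have mean: "vanishing (\<lambda>x. F (Suc m) x - D m x)"
    using slowly_oscillating_unit_mean[OF Suc.prems(1) Suc.prems(3)] by (simp add: D_def)
  have Dm: "vanishing (D m)"
  proof (cases "m = 0")
    case False
    then show ?thesis
      using Suc.IH[of D m] D vanishing_imp_slowly_oscillating[OF D0]
        slowly_oscillating_cong_diff[OF mean Suc.prems(3)] by auto
  qed (use D0 in simp)
  have "vanishing (\<lambda>x. D m x - F (Suc m) x)"
    using mean by (simp add: vanishing_def abs_minus_commute)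
  then have top: "vanishing (F (Suc m))"
    using vanishing_cong_diff Dm by blast
  show ?case
  proof (cases "i = Suc m")
    case False
    have "slowly_oscillating (F m)" if "m > 0"
    proof -
      obtain X where X: "\<And>e. e > 0 \<Longrightarrow> \<forall>x. X e \<le> \<bar>x\<bar> \<longrightarrow> \<bar>F (Suc m) x\<bar> \<le> e"
        using top unfolding vanishing_def by metis
      \<comment> \<open>The increment is the integral of \<open>F (Suc m)\<close> over an interval
        of length at most 1, which the margin 1 keeps beyond \<open>X e\<close>.\<close>
      have "\<bar>F m (x+t) - F m x\<bar> \<le> e" if "e > 0" "X e + 1 \<le> \<bar>x\<bar>" "0 \<le> t" "t \<le> 1" for e x t
      proof -
        have i: "(F (Suc m) has_integral F m (x+t) - F m x) {x..x+t}"
          using Suc.prems(1)[of m] that by (simp add: primitive_def)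
        have "norm (F m (x+t) - F m x) \<le> e * measure lborel (cbox x (x+t))"
          using X[OF that(1)] that i by (intro has_integral_bound) (auto simp: box_real)
        also have "\<dots> \<le> e" using that by simp
        finally show ?thesis by simp
      qed
      then show ?thesis unfolding slowly_oscillating_def by meson
    qed
    then show ?thesis using Suc.IH[of F i] Suc.prems False by (cases "m = 0") auto
  qed (use top in simp)
qed

section \<open>Integrating the almost everywhere derivative of an absolutely continuous
  function\<close>

text \<open>A gauge argument gives integrability and the value of the integral at once. Cells tagged
  where the derivative exists are controlled by differentiability. The other tags lie in a null set,
  and their cells are kept inside an open set so small that absolute continuity bounds the
  increments of \<open>h\<close>.\<close>

lemma has_integral_deriv_AE_abs_continuous:
  assumes ac: "abs_continuous_on {a..b} h" and ab: "a \<le> b"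
    and d: "AE x in lebesgue. (h has_real_derivative v x) (at x)"
  shows "(v has_integral h b - h a) {a..b}"
proof (cases "a = b")
  case True
  then show ?thesis using has_integral_refl(2)[of v b] by simp
next
  case False
  then have "a < b" using ab by simp
  define E where "E = {x. \<not> (h has_real_derivative v x) (at x)}"
  have negE: "negligible E"
    using d negligible_subset unfolding E_def by (auto simp: eventually_ae_filter negligible_iff_null_sets)
  \<comment> \<open>The value 0 on \<open>E\<close> removes the Riemann terms tagged there, however
    wild \<open>v\<close> is. Changing back to \<open>v\<close> on a negligible set at the end
    leaves the integral as it is.\<close>
  define w where "w x = (if x \<in> E then 0 else v x)" for x
  have "(w has_integral h b - h a) {a..b}"
    unfolding has_integral_factor_content_real
  proof (intro allI impI)
    fix e :: real assume "e > 0"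
    have der: "\<exists>d>0. \<forall>y. \<bar>y - x\<bar> < d \<longrightarrow> \<bar>h y - h x - (y - x) * v x\<bar> \<le> e / 2 * \<bar>y - x\<bar>" if "x \<notin> E" for x
    proof -
      have "\<forall>e>0. \<exists>d>0. \<forall>y. \<bar>y - x\<bar> < d \<longrightarrow> \<bar>h y - h x - (y - x) * v x\<bar> \<le> e * \<bar>y - x\<bar>"
        using that unfolding E_def has_field_derivative_def has_derivative_at_alt
        by (simp add: mult.commute[of "v x"])
      then show ?thesis using half_gt_zero[OF \<open>e > 0\<close>] by blast
    qed
    obtain r where r: "\<And>x. x \<notin> E \<Longrightarrow> r x > 0"
      "\<And>x y. x \<notin> E \<Longrightarrow> \<bar>y - x\<bar> < r x \<Longrightarrow> \<bar>h y - h x - (y - x) * v x\<bar> \<le> e / 2 * \<bar>y - x\<bar>"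
      using der by metis
    have pos: "0 < e / 2 * (b - a)" using \<open>e > 0\<close> \<open>a < b\<close> by simp
    from ac[unfolded abs_continuous_on_def, THEN spec, THEN mp, OF pos]
    obtain \<delta> where "\<delta> > 0" and \<delta>': "\<forall>\<D>. \<D> division_of \<Union>\<D> \<and> \<Union>\<D> \<subseteq> {a..b} \<and> (\<Sum>K\<in>\<D>. Sup K - Inf K) < \<delta> \<longrightarrow>
        (\<Sum>K\<in>\<D>. \<bar>h (Sup K) - h (Inf K)\<bar>) < e / 2 * (b - a)"
      by (elim exE conjE) (rule that)
    note \<delta> = \<delta>'[rule_format, OF conjI, OF _ conjI]
    obtain T where "open T" "E \<subseteq> T" "T \<in> lmeasurable" "measure lebesgue T < \<delta>"
    proof -
      obtain T where T: "open T" "E \<subseteq> T" "T - E \<in> lmeasurable" "emeasure lebesgue (T - E) < ennreal \<delta>"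
        using sets_lebesgue_outer_open[OF negligible_imp_sets[OF negE] \<open>\<delta> > 0\<close>] by metis
      have m: "T \<in> lmeasurable"
        using fmeasurable.Un[OF T(3) negligible_imp_measurable[OF negE]] T(2) by (simp add: Un_absorb2)
      have "measure lebesgue T = measure lebesgue (T - E)"
        using negE m by (simp add: measure_Diff_null_set negligible_iff_null_sets fmeasurableD)
      then have "measure lebesgue T < \<delta>"
        using T(3,4) by (simp add: emeasure_eq_measure2 ennreal_less_iff)
      then show ?thesis using that T m by blast
    qed
    \<comment> \<open>Fineness confines every cell tagged in \<open>E\<close> to \<open>T\<close>,
      so the total length of these cells is below \<delta>.\<close>
    define \<gamma> where "\<gamma> x = (if x \<in> E then T else ball x (r x))" for x
    have gauge: "gauge \<gamma>"
      using \<open>open T\<close> \<open>E \<subseteq> T\<close> r(1) by (auto simp: gauge_def \<gamma>_def)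
    have close: "norm ((\<Sum>(x, K)\<in>p. measure lborel K *\<^sub>R w x) - (h b - h a)) \<le> e * measure lborel {a..b}"
      if p: "p tagged_division_of {a..b}" and fine: "\<gamma> fine p" for p
    proof -
      note pd = tagged_division_ofD[OF p]
      have int: "\<exists>u v. K = {u..v} \<and> u \<le> v \<and> x \<in> {u..v}" if "(x, K) \<in> p" for x K
        using pd(2,4)[OF that] by (force simp: box_real)
      define p1 where "p1 = {(x, K) \<in> p. x \<in> E}"
      define p2 where "p2 = p - p1"
      have p12: "p1 \<subseteq> p" "p2 \<subseteq> p" "finite p1" "finite p2" "p1 \<inter> p2 = {}" "p = p1 \<union> p2"
        using pd(1) finite_subset[of p1 p] by (auto simp: p1_def p2_def)
      have tel: "b - a = (\<Sum>(x,K)\<in>p. Sup K - Inf K)" "h b - h a = (\<Sum>(x,K)\<in>p. h (Sup K) - h (Inf K))"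
        using additive_tagged_division_1[OF ab p, of "\<lambda>x. x"] additive_tagged_division_1[OF ab p, of h] by auto
      define t where "t z = (case z of (x, K) \<Rightarrow> measure lborel K *\<^sub>R w x - (h (Sup K) - h (Inf K)))" for z
      have "(\<Sum>(x, K)\<in>p. measure lborel K *\<^sub>R w x) - (h b - h a) = sum t p"
        unfolding tel by (simp add: t_def[abs_def] sum_subtractf case_prod_unfold)
      also have "\<dots> = sum t p1 + sum t p2"
        using p12 by (metis sum.union_disjoint)
      finally have split: "\<bar>(\<Sum>(x, K)\<in>p. measure lborel K *\<^sub>R w x) - (h b - h a)\<bar> \<le> \<bar>sum t p1\<bar> + \<bar>sum t p2\<bar>"
        by simp
      have "\<bar>sum t p2\<bar> \<le> (\<Sum>z\<in>p2. e / 2 * (case z of (x, K) \<Rightarrow> Sup K - Inf K))"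
        unfolding real_norm_def[symmetric]
      proof (rule sum_norm_le, clarify)
        fix x K assume xK: "(x, K) \<in> p2"
        then have "x \<notin> E" and xp: "(x, K) \<in> p" by (auto simp: p2_def p1_def)
        obtain u v' where uv: "K = {u..v'}" "u \<le> v'" "x \<in> {u..v'}" using int[OF xp] by blast
        have "K \<subseteq> ball x (r x)" using fineD[OF fine xp] \<open>x \<notin> E\<close> by (simp add: \<gamma>_def)
        then have "u \<in> ball x (r x)" "v' \<in> ball x (r x)"
          unfolding uv(1) using uv(2) by (meson atLeastAtMost_iff order_refl subsetD)+
        then have "\<bar>u - x\<bar> < r x" "\<bar>v' - x\<bar> < r x"
          by (simp_all add: dist_real_def abs_minus_commute)
        then have rr: "\<bar>h u - h x - (u - x) * v x\<bar> \<le> e / 2 * \<bar>u - x\<bar>"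
           "\<bar>h v' - h x - (v' - x) * v x\<bar> \<le> e / 2 * \<bar>v' - x\<bar>"
          using r(2)[OF \<open>x \<notin> E\<close>] by blast+
        \<comment> \<open>The tag lies between \<open>u\<close> and \<open>v'\<close>: the linear
          approximations at both endpoints are combined, and the distances of the endpoints from the
          tag add up to the length of the cell.\<close>
        have "t (x, K) = (h u - h x - (u - x) * v x) - (h v' - h x - (v' - x) * v x)"
          using uv \<open>x \<notin> E\<close> by (simp add: t_def w_def algebra_simps)
        also have "\<bar>\<dots>\<bar> \<le> \<bar>h u - h x - (u - x) * v x\<bar> + \<bar>h v' - h x - (v' - x) * v x\<bar>"
          by (rule abs_triangle_ineq4)
        also have "\<dots> \<le> e / 2 * \<bar>u - x\<bar> + e / 2 * \<bar>v' - x\<bar>"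
          by (rule add_mono[OF rr])
        also have "\<dots> = e / 2 * (Sup K - Inf K)"
          using uv by (simp add: field_simps)
        finally show "norm (t (x, K)) \<le> e / 2 * (Sup K - Inf K)" by simp
      qed
      also have "\<dots> \<le> (\<Sum>z\<in>p. e / 2 * (case z of (x, K) \<Rightarrow> Sup K - Inf K))"
        using int pd(1) p12(2) \<open>e > 0\<close> by (intro sum_mono2) fastforce+
      also have "\<dots> = e / 2 * (b - a)"
        by (simp add: tel(1) sum_distrib_left)
      finally have s2: "\<bar>sum t p2\<bar> \<le> e / 2 * (b - a)" .
      have part: "p1 tagged_partial_division_of {a..b}"
        using p p12(1) tagged_partial_division_subset tagged_division_of_def by blast
      have td: "p1 tagged_division_of \<Union>(snd ` p1)"
        using tagged_partial_division_of_Union_self[OF part] .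
      have dv: "(snd ` p1) division_of \<Union>(snd ` p1)" using division_of_tagged_division[OF td] .
      have sub: "\<Union>(snd ` p1) \<subseteq> {a..b}" using pd(3) p12(1) by force
      have subT: "\<Union>(snd ` p1) \<subseteq> T" using fineD[OF fine] by (force simp: \<gamma>_def p1_def)
      \<comment> \<open>Cells of a division overlap in null sets only, so their lengths add up to
        the measure of their union, which lies in \<open>T\<close>.\<close>
      have "(\<Sum>K\<in>snd ` p1. Sup K - Inf K) = (\<Sum>K\<in>snd ` p1. measure lebesgue K)"
        using p12(1) by (intro sum.cong refl) (auto dest!: subsetD int)
      also have "\<dots> = measure lebesgue (\<Union>(snd ` p1))"
        using content_division[OF dv] by simp
      also have "\<dots> \<le> measure lebesgue T"
        using subT \<open>T \<in> lmeasurable\<close> lmeasurable_division[OF dv]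
        by (intro measure_mono_fmeasurable) auto
      also have "\<dots> < \<delta>" by fact
      finally have "(\<Sum>K\<in>snd ` p1. \<bar>h (Sup K) - h (Inf K)\<bar>) < e / 2 * (b - a)"
        using \<delta>[OF dv sub] by blast
      moreover have "(\<Sum>(x,K)\<in>p1. \<bar>h (Sup K) - h (Inf K)\<bar>) = (\<Sum>K\<in>snd ` p1. \<bar>h (Sup K) - h (Inf K)\<bar>)"
      proof -
        \<comment> \<open>\<open>Sup\<close> and \<open>Inf\<close> of the empty set are unspecified reals.\<close>
        let ?d = "\<lambda>K. if K = {} then 0 else \<bar>h (Sup K) - h (Inf K)\<bar>"
        have ne: "K \<noteq> {}" if "(x, K) \<in> p1" for x K using that pd(2) p12(1) by blast
        have "(\<Sum>(x,K)\<in>p1. \<bar>h (Sup K) - h (Inf K)\<bar>) = (\<Sum>(x,K)\<in>p1. ?d K)"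
          using ne by (intro sum.cong refl) auto
        also have "\<dots> = (\<Sum>K\<in>snd ` p1. ?d K)"
        proof (rule sum.over_tagged_division_lemma[OF td])
          fix u v :: real assume "box u v = {}"
          then show "?d (cbox u v) = 0"
            by (cases "u = v") auto
        qed
        also have "\<dots> = (\<Sum>K\<in>snd ` p1. \<bar>h (Sup K) - h (Inf K)\<bar>)"
          using ne by (intro sum.cong refl) auto
        finally show ?thesis .
      qed
      moreover have "\<bar>sum t p1\<bar> \<le> (\<Sum>(x,K)\<in>p1. \<bar>h (Sup K) - h (Inf K)\<bar>)"
        unfolding real_norm_def[symmetric]
        by (rule sum_norm_le) (auto simp: t_def w_def p1_def)
      ultimately show ?thesis using split s2 \<open>a < b\<close> by simp
    qed
    show "\<exists>\<gamma>. gauge \<gamma> \<and> (\<forall>p. p tagged_division_of {a..b} \<and> \<gamma> fine p \<longrightarrow>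
        norm ((\<Sum>(x, K)\<in>p. measure lborel K *\<^sub>R w x) - (h b - h a)) \<le> e * measure lborel {a..b})"
      by (intro exI conjI allI impI, rule gauge) (elim conjE, rule close)
  qed
  then show ?thesis
    by (rule has_integral_spike[OF negE, rotated]) (simp add: w_def)
qed

section \<open>Finite total variation\<close>

lemma total_variation_ge:
  fixes t :: "nat \<Rightarrow> real"
  assumes "strict_mono_on {0..m} t"
  shows "(\<Sum>i = 1..m. ennreal \<bar>h (t i) - h (t (i - 1))\<bar>) \<le> total_variation h"
  unfolding total_variation_def by (intro Sup_upper CollectI exI[of _ m] exI[of _ t] conjI refl assms)

lemma variation_sum_le:
  fixes t :: "nat \<Rightarrow> real"
  assumes "strict_mono_on {0..m} t" "total_variation h < \<infinity>"
  shows "(\<Sum>i = 1..m. \<bar>h (t i) - h (t (i - 1))\<bar>) \<le> enn2real (total_variation h)"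
proof -
  have "ennreal (\<Sum>i = 1..m. \<bar>h (t i) - h (t (i - 1))\<bar>) \<le> total_variation h"
    using total_variation_ge[OF assms(1), of h] by (simp add: sum_ennreal)
  also have "\<dots> = ennreal (enn2real (total_variation h))" using assms(2) by simp
  finally show ?thesis by (simp add: ennreal_le_iff)
qed

lemma strict_mono_on_atMost_Suc:
  fixes t :: "nat \<Rightarrow> real"
  assumes "\<And>i. i < m \<Longrightarrow> t i < t (Suc i)"
  shows "strict_mono_on {0..m} t"
proof (rule strict_mono_onI)
  fix r s assume "r \<in> {0..m}" "s \<in> {0..m}" "r < s"
  then show "t r < t s"
  proof (induction s)
    case (Suc s)
    then have "t s < t (Suc s)" using assms by simp
    then show ?case using Suc by (cases "r = s") (auto intro: less_trans)
  qed simp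
qed

text \<open>A partition whose variation sum comes within \<open>e\<close> of the supremum leaves
  less than \<open>e\<close> of variation outside its range. Far out, two further points at distance
  at most 1 can be added at one end of it, so the increment between them is small.\<close>

lemma finite_total_variation_imp_slowly_oscillating:
  assumes fin: "total_variation h < \<infinity>"
  shows "slowly_oscillating h"
  unfolding slowly_oscillating_def
proof (intro allI impI)
  fix e :: real assume "e > 0"
  let ?V = "enn2real (total_variation h)"
  have "\<exists>(m :: nat) t. strict_mono_on {0..m} t \<and> ?V - e < (\<Sum>i = 1..m. \<bar>h (t i) - h (t (i - 1))\<bar>)"
  proof (rule ccontr)
    assume "\<not> ?thesis"
    then have *: "(\<Sum>i = 1..m. \<bar>h (t i) - h (t (i - 1))\<bar>) \<le> ?V - e" if "strict_mono_on {0..m} t" for m :: nat and t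
      using that by (meson not_less)
    \<comment> \<open>The partition with \<open>m = 0\<close> has variation sum 0. This excludes a
      negative \<open>?V - e\<close>, which \<open>ennreal\<close> would truncate to 0.\<close>
    have "0 \<le> ?V - e" using *[of 0 real] by (simp add: strict_mono_onI)
    have "total_variation h \<le> ennreal (?V - e)"
      by (subst total_variation_def, rule Sup_least) (use * in \<open>auto simp: sum_ennreal intro!: ennreal_leI\<close>)
    then have "ennreal ?V \<le> ennreal (?V - e)" using fin by simp
    then show False using \<open>0 \<le> ?V - e\<close> \<open>e > 0\<close> by (simp add: ennreal_le_iff)
  qed
  then obtain m :: nat and t where t: "strict_mono_on {0..m} t"
    and big: "?V - e < (\<Sum>i = 1..m. \<bar>h (t i) - h (t (i - 1))\<bar>)" by blast
  have tmono: "t i < t (Suc i)" if "i < m" for i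
    using t that by (auto simp: strict_mono_on_def)
  have "\<bar>h (x + s) - h x\<bar> \<le> e" if x: "\<bar>t 0\<bar> + \<bar>t m\<bar> + 2 \<le> \<bar>x\<bar>" and s: "0 \<le> s" "s \<le> 1" for x s
  proof (cases "s = 0")
    case False
    then have "s > 0" using s by simp
    show ?thesis
    proof (cases "x \<ge> 0")
      case True
      define u where "u i = (if i \<le> m then t i else if i = Suc m then x else x + s)" for i
      have "strict_mono_on {0..Suc (Suc m)} u"
        using tmono x \<open>s > 0\<close> True
        by (intro strict_mono_on_atMost_Suc) (auto simp: u_def less_Suc_eq)
      then have "(\<Sum>i = 1..Suc (Suc m). \<bar>h (u i) - h (u (i - 1))\<bar>) \<le> ?V"
        using variation_sum_le fin by blast
      moreover have "(\<Sum>i = 1..m. \<bar>h (u i) - h (u (i - 1))\<bar>) = (\<Sum>i = 1..m. \<bar>h (t i) - h (t (i - 1))\<bar>)"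
        by (intro sum.cong) (auto simp: u_def)
      ultimately show ?thesis using big by (simp add: u_def)
    next
      case False
      define u where "u i = (if i = 0 then x else if i = 1 then x + s else t (i - 2))" for i :: nat
      have "strict_mono_on {0..Suc (Suc m)} u"
      proof (rule strict_mono_on_atMost_Suc)
        fix i assume "i < Suc (Suc m)"
        then consider "i = 0" | "i = 1" | j where "i = Suc (Suc j)" "j < m"
          by (cases i; cases "i - 1"; force)
        then show "u i < u (Suc i)"
          using tmono x \<open>s > 0\<close> s False by cases (auto simp: u_def)
      qed
      then have "(\<Sum>i = 1..Suc (Suc m). \<bar>h (u i) - h (u (i - 1))\<bar>) \<le> ?V"
        using variation_sum_le fin by blast
      moreover have "(\<Sum>i = 1..Suc (Suc m). \<bar>h (u i) - h (u (i - 1))\<bar>)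
          = (\<Sum>i < Suc (Suc m). \<bar>h (u (Suc i)) - h (u i)\<bar>)"
        by (simp only: One_nat_def sum.atLeast1_atMost_eq diff_Suc_Suc diff_zero)
      moreover have "\<dots> = \<bar>h (x + s) - h x\<bar> + \<bar>h (t 0) - h (x + s)\<bar> + (\<Sum>i < m. \<bar>h (t (Suc i)) - h (t i)\<bar>)"
        by (simp only: sum.lessThan_Suc_shift) (simp add: u_def numeral_2_eq_2)
      moreover have "(\<Sum>i = 1..m. \<bar>h (t i) - h (t (i - 1))\<bar>) = (\<Sum>i < m. \<bar>h (t (Suc i)) - h (t i)\<bar>)"
        by (simp only: One_nat_def sum.atLeast1_atMost_eq diff_Suc_Suc diff_zero)
      ultimately show ?thesis using big by linarith
    qed
  qed (use \<open>e > 0\<close> in simp)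
  then show "\<exists>X. \<forall>x t. X \<le> \<bar>x\<bar> \<longrightarrow> 0 \<le> t \<longrightarrow> t \<le> 1 \<longrightarrow> \<bar>h (x + t) - h x\<bar> \<le> e" by blast
qed

lemma total_variation_mono_bounded:
  assumes "mono h" "\<And>x y. h y - h x \<le> c"
  shows "total_variation h \<le> ennreal c"
  unfolding total_variation_def
proof (rule Sup_least, clarify)
  fix m and t :: "nat \<Rightarrow> real" assume t: "strict_mono_on {0..m} t"
  have "(\<Sum>i = 1..m. \<bar>h (t i) - h (t (i - 1))\<bar>) = (\<Sum>i = 1..m. h (t i) - h (t (i - 1)))"
  proof (intro sum.cong refl abs_of_nonneg)
    fix i assume "i \<in> {1..m}"
    then have "t (i - 1) < t i" using t by (auto simp: strict_mono_on_def)
    then show "0 \<le> h (t i) - h (t (i - 1))" using assms(1) by (simp add: monoD)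
  qed
  also have "\<dots> = (\<Sum>i < m. h (t (Suc i)) - h (t i))"
    by (simp only: One_nat_def sum.atLeast1_atMost_eq diff_Suc_Suc diff_zero)
  also have "\<dots> = h (t m) - h (t 0)" by (rule sum_lessThan_telescope)
  also have "\<dots> \<le> c" by (rule assms)
  finally show "(\<Sum>i = 1..m. ennreal \<bar>h (t i) - h (t (i - 1))\<bar>) \<le> ennreal c"
    by (simp add: sum_ennreal ennreal_leI)
qed

section \<open>Increments of a primitive over parts of a unit interval\<close>

text \<open>For \<open>H' = h\<close> and \<open>H(x + 1) = H x\<close>, the increment \<open>H y - H x\<close> is \<open>d (1 - d)\<close> times the difference
  of the means of \<open>h\<close> over \<open>[x, y]\<close> and \<open>[y, x + 1]\<close>. Parametrising the two intervals in opposite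
  directions puts the paired points at distance exactly \<open>t\<close>, whatever \<open>d\<close> is.\<close>

lemma primitive_increment_bound:
  assumes p: "primitive h H" and xy: "x \<le> y" "y \<le> x + 1"
    and c: "(c has_integral I) {0..1}"
    and bound: "\<And>z t. x \<le> z \<Longrightarrow> z \<le> x + 1 \<Longrightarrow> 0 \<le> t \<Longrightarrow> t \<le> 1 \<Longrightarrow> \<bar>h (z + t) - h z\<bar> \<le> c t"
    and e: "\<bar>H (x + 1) - H x\<bar> \<le> e"
  shows "\<bar>H y - H x\<bar> \<le> (y - x) * (1 - (y - x)) * I + e"
proof -
  define d where "d = y - x"
  consider "d = 0" | "d = 1" | "0 < d" "d < 1" using xy by (force simp: d_def)
  then show ?thesis
  proof cases
    case 1
    then show ?thesis using e by (simp add: d_def)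
  next
    case 2
    then have "y = x + 1" by (simp add: d_def)
    then show ?thesis using e by simp
  next
    case 3
    have y: "y = x + d" by (simp add: d_def)
    have hx: "(h has_integral H y - H x) (cbox x y)" and hy: "(h has_integral H (x + 1) - H y) (cbox y (x + 1))"
      using p xy by (auto simp: primitive_def)
    have "((\<lambda>t. h (d *\<^sub>R t + x)) has_integral (H y - H x) /\<^sub>R d ^ DIM(real))
        (cbox ((x - x) /\<^sub>R d) ((y - x) /\<^sub>R d))"
      by (rule has_integral_affinity'[OF hx 3(1)])
    then have "((\<lambda>t. h (x + d * t)) has_integral (H y - H x) / d) {0..1}"
      using 3 by (simp add: y add.commute divide_inverse mult.commute)
    \<comment> \<open>Reversing this parametrisation pairs \<open>x + d * (1 - t)\<close> with
      \<open>y + (1 - d) * t\<close>, which lies exactly \<open>t\<close> further right.\<close>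
    from has_integral_reflect_lemma_real[OF this]
    have "((\<lambda>t. h (x + d * - t)) has_integral (H y - H x) / d) {-1..0}" by simp
    then have i1: "((\<lambda>t. h (x + d * (1 - t))) has_integral (H y - H x) / d) {0..1}"
      using has_integral_shift_Icc_real[of "\<lambda>t. h (x + d * - t)" "-1" _ 0 1] by (simp add: o_def algebra_simps)
    have "((\<lambda>t. h ((1 - d) *\<^sub>R t + y)) has_integral (H (x + 1) - H y) /\<^sub>R (1 - d) ^ DIM(real))
        (cbox ((y - y) /\<^sub>R (1 - d)) ((x + 1 - y) /\<^sub>R (1 - d)))"
      using 3 by (intro has_integral_affinity'[OF hy]) simp
    then have i2: "((\<lambda>t. h (y + (1 - d) * t)) has_integral (H (x + 1) - H y) / (1 - d)) {0..1}"
      using 3 by (simp add: y add.commute divide_inverse mult.commute)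
    let ?D = "(H (x + 1) - H y) / (1 - d) - (H y - H x) / d"
    have i: "((\<lambda>t. h (y + (1 - d) * t) - h (x + d * (1 - t))) has_integral ?D) {0..1}"
      by (rule has_integral_diff[OF i2 i1])
    have b: "\<bar>h (y + (1 - d) * t) - h (x + d * (1 - t))\<bar> \<le> c t" if "t \<in> {0..1}" for t
    proof -
      have "0 \<le> d * (1 - t)" "d * (1 - t) \<le> 1" using that 3 by (auto intro: mult_le_one)
      moreover have "y + (1 - d) * t = x + d * (1 - t) + t" by (simp add: y algebra_simps)
      ultimately show ?thesis using bound[of "x + d * (1 - t)" t] that by simp
    qed
    have "\<bar>?D\<bar> \<le> I"
    proof (rule abs_leI)
      show "?D \<le> I" by (rule has_integral_le[OF i c]) (use b in \<open>force simp: abs_le_iff\<close>)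
      show "- ?D \<le> I" by (rule has_integral_le[OF has_integral_neg[OF i] c]) (use b in \<open>force simp: abs_le_iff\<close>)
    qed
    then have P: "\<bar>d * (1 - d) * ?D\<bar> \<le> d * (1 - d) * I"
      using 3 by (simp only: abs_mult) (simp add: mult_left_mono)
    have "d * \<bar>H (x + 1) - H x\<bar> \<le> 1 * e" using 3 e by (intro mult_mono) auto
    then have A: "\<bar>d * (H (x + 1) - H x)\<bar> \<le> e" using 3 by (simp add: abs_mult)
    \<comment> \<open>For periodic \<open>H\<close> the first term is zero. Here the unit increment
      enters with weight \<open>d\<close> and costs at most \<open>e\<close>.\<close>
    have "H y - H x = d * (H (x + 1) - H x) - d * (1 - d) * ?D"
      using 3 by (simp add: field_simps)
    also have "\<bar>\<dots>\<bar> \<le> \<bar>d * (H (x + 1) - H x)\<bar> + \<bar>d * (1 - d) * ?D\<bar>" by (rule abs_triangle_ineq4)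
    also have "\<dots> \<le> e + d * (1 - d) * I" using A P by (rule add_mono)
    finally show ?thesis unfolding d_def by simp
  qed
qed

section \<open>Window sums and their boundary terms\<close>

text \<open>The index \<open>j\<close> stands for the integer z = j - N, so the window is
  \<bar>z\<bar> \<le> N. Counting from its left end makes unit shifts telescope.\<close>

definition window_sum :: "(real \<Rightarrow> real) \<Rightarrow> nat \<Rightarrow> real \<Rightarrow> real" where
  "window_sum F N x = (\<Sum>j < 2 * N + 1. F (x - real N + real j))"

lemma window_sum_unit_step: "window_sum F N (x + 1) - window_sum F N x = F (x + 1 + real N) - F (x - real N)"
proof -
  define g where "g j = F (x - real N + real j)" for j
  have "window_sum F N (x + 1) - window_sum F N x = (\<Sum>j < 2 * N + 1. g (Suc j) - g j)"
    unfolding window_sum_def g_def sum_subtractf by (intro arg_cong2[of _ _ _ _ "(-)"] sum.cong) (auto simp: algebra_simps)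
  also have "\<dots> = g (2 * N + 1) - g 0" by (rule sum_lessThan_telescope)
  also have "\<dots> = F (x + 1 + real N) - F (x - real N)" by (simp add: g_def algebra_simps)
  finally show ?thesis .
qed

lemma primitive_window_sum:
  assumes "primitive h H"
  shows "primitive (window_sum h N) (window_sum H N)"
proof -
  have "primitive (\<lambda>x. \<Sum>j<2 * N + 1. h ((real j - real N) + x)) (\<lambda>x. \<Sum>j<2 * N + 1. H ((real j - real N) + x))"
    by (intro primitive_sum primitive_translate assms) auto
  then show ?thesis
    unfolding window_sum_def[abs_def] by (simp add: algebra_simps)
qed

lemma window_sum_boundary:
  assumes "vanishing F" "e > 0"
  obtains N0 where "\<And>N x. N0 \<le> N \<Longrightarrow> \<bar>x\<bar> \<le> R \<Longrightarrow> \<bar>window_sum F N (x + 1) - window_sum F N x\<bar> \<le> e"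
proof -
  obtain X where X: "\<And>x. X \<le> \<bar>x\<bar> \<Longrightarrow> \<bar>F x\<bar> \<le> e / 2"
    using assms unfolding vanishing_def by (meson half_gt_zero)
  \<comment> \<open>Such \<open>N\<close> move both boundary points beyond \<open>X\<close>,
    uniformly for \<open>x\<close> in [-R, R].\<close>
  have "\<bar>window_sum F N (x + 1) - window_sum F N x\<bar> \<le> e" if "nat \<lceil>\<bar>X\<bar> + R\<rceil> \<le> N" "\<bar>x\<bar> \<le> R" for N x
  proof -
    have "\<bar>X\<bar> + R \<le> real N" using that by linarith
    then have "X \<le> \<bar>x + 1 + real N\<bar>" "X \<le> \<bar>x - real N\<bar>"
      using that by linarith+
    then have "\<bar>F (x + 1 + real N)\<bar> \<le> e / 2" "\<bar>F (x - real N)\<bar> \<le> e / 2"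
      using X by blast+
    then show ?thesis unfolding window_sum_unit_step by linarith
  qed
  then show ?thesis using that by blast
qed

lemma sum_pairs: "(\<Sum>i = 1..2 * n. a i) = (\<Sum>j<n. a (2 * j + 1) + a (2 * j + 2))" for a :: "nat \<Rightarrow> real"
  by (induction n) (auto simp: add.assoc)

text \<open>The translates of \<open>x\<close> and \<open>y\<close> interleave to a single partition
  from x - N to x + 1 + N. Its steps alternate between translates of [x, y] and of [y, x + 1], so
  one variation sum dominates both increments together.\<close>

lemma window_sum_variation:
  assumes xy: "x < y" "y < x + 1" and fin: "total_variation v < \<infinity>"
  shows "\<bar>window_sum v N y - window_sum v N x\<bar> + \<bar>window_sum v N (x + 1) - window_sum v N y\<bar>
    \<le> enn2real (total_variation v)"
proof -
  define t where "t i = (if even i then x else y) - real N + real (i div 2)" for i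
  have t_simps: "t (2 * j) = x - real N + real j" "t (2 * j + 1) = y - real N + real j"
    "t (2 * j + 2) = x + 1 - real N + real j" for j by (simp_all add: t_def)
  have "strict_mono_on {0..2 * (2 * N + 1)} t"
  proof (rule strict_mono_on_atMost_Suc)
    fix i show "t i < t (Suc i)"
      using xy by (cases "even i") (auto simp: t_def elim!: evenE oddE)
  qed
  then have "(\<Sum>i = 1..2 * (2 * N + 1). \<bar>v (t i) - v (t (i - 1))\<bar>) \<le> enn2real (total_variation v)"
    using fin by (rule variation_sum_le)
  moreover have "(\<Sum>i = 1..2 * (2 * N + 1). \<bar>v (t i) - v (t (i - 1))\<bar>)
      = (\<Sum>j<2 * N + 1. \<bar>v (t (2 * j + 1)) - v (t (2 * j))\<bar>) + (\<Sum>j<2 * N + 1. \<bar>v (t (2 * j + 2)) - v (t (2 * j + 1))\<bar>)"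
    unfolding sum_pairs sum.distrib by simp
  moreover have "\<bar>window_sum v N y - window_sum v N x\<bar> \<le> (\<Sum>j<2 * N + 1. \<bar>v (t (2 * j + 1)) - v (t (2 * j))\<bar>)"
    unfolding window_sum_def t_simps sum_subtractf[symmetric] by (rule sum_abs)
  moreover have "\<bar>window_sum v N (x + 1) - window_sum v N y\<bar> \<le> (\<Sum>j<2 * N + 1. \<bar>v (t (2 * j + 2)) - v (t (2 * j + 1))\<bar>)"
    unfolding window_sum_def t_simps sum_subtractf[symmetric] by (rule sum_abs)
  ultimately show ?thesis by linarith
qed

section \<open>Moduli of continuity of window sums\<close>

text \<open>A modulus of continuity for large windows, phrased for the windows themselves: no limit
  is formed for the derivatives. Uniformity over bounded \<open>x\<close> allows the bound to be
  integrated over a unit interval.\<close>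

definition asymptotic_modulus :: "(real \<Rightarrow> real) \<Rightarrow> (real \<Rightarrow> real) \<Rightarrow> bool" where
  "asymptotic_modulus F c \<longleftrightarrow> (\<forall>e>0. \<forall>R. \<exists>N0. \<forall>N\<ge>N0. \<forall>x d. \<bar>x\<bar> \<le> R \<longrightarrow> 0 \<le> d \<longrightarrow> d \<le> 1 \<longrightarrow>
     \<bar>window_sum F N (x + d) - window_sum F N x\<bar> \<le> c d + e)"

lemma asymptotic_modulus_total_variation:
  assumes van: "vanishing v" and fin: "total_variation v < \<infinity>"
  shows "asymptotic_modulus v (\<lambda>_. enn2real (total_variation v) / 2)"
  unfolding asymptotic_modulus_def
proof (intro allI impI)
  fix e R :: real assume "e > 0"
  let ?V = "enn2real (total_variation v)"
  obtain N0 where N0: "\<And>N x. N0 \<le> N \<Longrightarrow> \<bar>x\<bar> \<le> R \<Longrightarrow> \<bar>window_sum v N (x + 1) - window_sum v N x\<bar> \<le> e"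
    using window_sum_boundary[OF van \<open>e > 0\<close>] by blast
  have "\<bar>window_sum v N (x + d) - window_sum v N x\<bar> \<le> ?V / 2 + e"
    if hyps: "N0 \<le> N" "\<bar>x\<bar> \<le> R" "0 \<le> d" "d \<le> 1" for N x d
  proof -
    have V: "0 \<le> ?V" by simp
    \<comment> \<open>\<open>window_sum_variation\<close> asks for x < x + d < x + 1. For such
      \<open>d\<close> the absolute values of the two increments have sum at most \<open>?V\<close>
      and differ by at most \<open>e\<close>, whence the half.\<close>
    consider "d = 0" | "d = 1" | "0 < d" "d < 1" using hyps by force
    then show ?thesis
    proof cases
      case 1
      then show ?thesis using V \<open>e > 0\<close> by simp
    next
      case 2
      show ?thesis using V N0[OF hyps(1,2)] unfolding 2 by linarith
    next
      case 3
      then show ?thesis using window_sum_variation[of x "x + d" v N] fin N0[OF hyps(1,2)] \<open>e > 0\<close> by simp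
    qed
  qed
  then show "\<exists>N0. \<forall>N\<ge>N0. \<forall>x d. \<bar>x\<bar> \<le> R \<longrightarrow> 0 \<le> d \<longrightarrow> d \<le> 1 \<longrightarrow>
     \<bar>window_sum v N (x + d) - window_sum v N x\<bar> \<le> ?V / 2 + e" by blast
qed

lemma asymptotic_modulus_primitive:
  assumes p: "primitive h H" and h: "asymptotic_modulus h c" and I: "(c has_integral I) {0..1}"
    and van: "vanishing H"
  shows "asymptotic_modulus H (\<lambda>d. d * (1 - d) * I)"
  unfolding asymptotic_modulus_def
proof (intro allI impI)
  fix e R :: real assume "e > 0"
  then have e2: "e / 2 > 0" by simp
  obtain N0 where N0: "\<And>N x. N0 \<le> N \<Longrightarrow> \<bar>x\<bar> \<le> R \<Longrightarrow> \<bar>window_sum H N (x + 1) - window_sum H N x\<bar> \<le> e / 2"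
    using window_sum_boundary[OF van e2] by blast
  \<comment> \<open>The radius is \<open>R + 1\<close> because the base points run through
    [x, x + 1].\<close>
  obtain N1 where N1: "\<And>N x d. N1 \<le> N \<Longrightarrow> \<bar>x\<bar> \<le> R + 1 \<Longrightarrow> 0 \<le> d \<Longrightarrow> d \<le> 1 \<Longrightarrow>
     \<bar>window_sum h N (x + d) - window_sum h N x\<bar> \<le> c d + e / 2"
    using h e2 unfolding asymptotic_modulus_def by meson
  \<comment> \<open>The slack \<open>e / 2\<close> raises \<open>I\<close> by \<open>e / 2\<close>,
    weighted by d (1 - d) \<le> 1. The other \<open>e / 2\<close> pays for the boundary
    terms.\<close>
  have I': "((\<lambda>t. c t + e / 2) has_integral I + e / 2) {0..1}"
    using has_integral_add[OF I has_integral_const_real[of "e / 2" 0 1]] by simp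
  have "\<bar>window_sum H N (x + d) - window_sum H N x\<bar> \<le> d * (1 - d) * I + e"
    if "max N0 N1 \<le> N" "\<bar>x\<bar> \<le> R" "0 \<le> d" "d \<le> 1" for N x d
  proof -
    have "\<bar>window_sum H N (x + d) - window_sum H N x\<bar> \<le> (x + d - x) * (1 - (x + d - x)) * (I + e / 2) + e / 2"
      using that by (intro primitive_increment_bound[OF primitive_window_sum[OF p] _ _ I'] N1 N0) auto
    also have "\<dots> = d * (1 - d) * I + (d * (1 - d)) * (e / 2) + e / 2" by (simp add: algebra_simps)
    also have "\<dots> \<le> d * (1 - d) * I + 1 * (e / 2) + e / 2"
      using that e2 by (intro add_mono mult_right_mono order_refl) (auto intro: mult_le_one)
    finally show ?thesis by simp
  qed
  then show "\<exists>N0. \<forall>N\<ge>N0. \<forall>x d. \<bar>x\<bar> \<le> R \<longrightarrow> 0 \<le> d \<longrightarrow> d \<le> 1 \<longrightarrow>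
     \<bar>window_sum H N (x + d) - window_sum H N x\<bar> \<le> d * (1 - d) * I + e" by blast
qed

lemma has_integral_parabola: "((\<lambda>d. d * (1 - d) * C) has_integral C / 6) {0..1::real}"
proof -
  have "((\<lambda>d. d * (1 - d) * C) has_integral (C * (1^2 / 2 - 1^3 / 3) - C * (0^2 / 2 - 0^3 / 3))) {0..1::real}"
    by (rule fundamental_theorem_of_calculus)
      (auto intro!: derivative_eq_intros simp flip: has_real_derivative_iff_has_vector_derivative
        simp: algebra_simps power2_eq_square)
  then show ?thesis by simp
qed

text \<open>\<open>n = 0\<close> is one integration below the top, where the constant modulus
  integrates to half the variation; each further integration divides by 6. The condition
  \<open>n < k\<close> keeps the index at least 1. In the application \<open>F 0\<close> is a
  distribution function, which does not vanish at infinity.\<close>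

lemma asymptotic_modulus_primitive_chain:
  assumes "\<And>i. i < Suc k \<Longrightarrow> primitive (F (Suc i)) (F i)"
    and van: "\<And>i. 1 \<le> i \<Longrightarrow> i \<le> Suc k \<Longrightarrow> vanishing (F i)"
    and "total_variation (F (Suc k)) < \<infinity>" "n < k"
  shows "asymptotic_modulus (F (k - n)) (\<lambda>d. d * (1 - d) * (enn2real (total_variation (F (Suc k))) / (2 * 6 ^ n)))"
  using \<open>n < k\<close>
proof (induction n)
  case 0
  let ?V = "enn2real (total_variation (F (Suc k)))"
  have "((\<lambda>_. ?V / 2) has_integral ?V / 2) {0..1::real}"
    using has_integral_const_real[of "?V / 2" 0 1] by simp
  then show ?case
    using asymptotic_modulus_primitive[OF assms(1)[of k] asymptotic_modulus_total_variation[OF van assms(3)]] van[of k] 0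
    by fastforce
next
  case (Suc n)
  have "Suc (k - Suc n) = k - n" using Suc by simp
  then show ?case
    using asymptotic_modulus_primitive[OF _ Suc.IH has_integral_parabola, of "F (k - Suc n)"]
      assms(1)[of "k - Suc n"] van[of "k - Suc n"] Suc.prems by (simp add: mult.assoc mult.commute[of 6])
qed

section \<open>From window sums to the periodization\<close>

text \<open>Sums in \<open>ennreal\<close> always exist as limits over the finite sets of integers,
  and the windows are cofinal among these.\<close>

lemma window_sum_tendsto_periodization:
  assumes "\<And>x. 0 \<le> f x"
  shows "(\<lambda>N. ennreal (window_sum f N x)) \<longlonglongrightarrow> periodization f x"
proof -
  let ?g = "\<lambda>z::int. ennreal (f (of_int z + x))"
  have "(?g has_sum periodization f x) UNIV"
    unfolding periodization_def by (intro has_sum_infsum nonneg_summable_on_complete) simp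
  moreover have "filterlim (\<lambda>N. {-int N..int N}) (finite_subsets_at_top UNIV) sequentially"
    unfolding filterlim_finite_subsets_at_top
  proof (intro allI impI)
    fix X :: "int set" assume "finite X \<and> X \<subseteq> UNIV"
    then obtain b where "X \<subseteq> {i. \<bar>i\<bar> \<le> b}"
      unfolding finite_int_iff_bounded_le by auto
    then have "X \<subseteq> {-int N..int N}" if "N \<ge> nat b" for N using that by force
    then show "\<forall>\<^sub>F N in sequentially. finite {-int N..int N} \<and> X \<subseteq> {-int N..int N} \<and> {-int N..int N} \<subseteq> UNIV"
      by (auto intro: eventually_sequentiallyI[of "nat b"])
  qed
  ultimately have "(\<lambda>N. sum ?g {-int N..int N}) \<longlonglongrightarrow> periodization f x"
    unfolding has_sum_def using filterlim_compose by blast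
  moreover have "sum ?g {-int N..int N} = ennreal (window_sum f N x)" for N
  proof -
    have "sum ?g {-int N..int N} = ennreal (\<Sum>z\<in>{-int N..int N}. f (of_int z + x))"
      using assms by (simp add: sum_ennreal)
    also have "(\<Sum>z\<in>{-int N..int N}. f (of_int z + x)) = window_sum f N x"
      unfolding window_sum_def
      by (rule sum.reindex_bij_witness[of _ "\<lambda>j. int j - int N" "\<lambda>z. nat (z + int N)"]) (auto simp: algebra_simps)
    finally show ?thesis .
  qed
  ultimately show ?thesis by simp
qed

lemma integrable_lborel_has_primitive:
  fixes f :: "real \<Rightarrow> real"
  assumes int: "integrable lborel f" and nonneg: "\<And>x. 0 \<le> f x"
  obtains F where "primitive f F" "mono F" "\<And>x y. F y - F x \<le> integral\<^sup>L lborel f"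
proof -
  have "f absolutely_integrable_on UNIV"
    using integrable_on_lborel[OF int] nonneg by (intro nonnegative_absolutely_integrable_1) auto
  then have on: "f integrable_on S" if "S \<in> sets lebesgue" for S
    using set_integrable_subset[of lebesgue UNIV f S] that by (auto intro: set_lebesgue_integral_eq_integral(1))
  define F where "F x = integral {..x} f" for x
  have p: "primitive f F"
    unfolding primitive_def
  proof (intro allI impI)
    fix a b :: real assume "a \<le> b"
    have "(f has_integral integral {..a} f + integral {a..b} f) ({..a} \<union> {a..b})"
    proof (rule has_integral_Un)
      have "{..a} \<inter> {a..b} = {a}" using \<open>a \<le> b\<close> by auto
      then show "negligible ({..a} \<inter> {a..b})" by simp
    qed (auto intro!: integrable_integral on)
    moreover have "{..a} \<union> {a..b} = {..b}" using \<open>a \<le> b\<close> by auto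
    ultimately have "F b - F a = integral {a..b} f" unfolding F_def by (simp add: integral_unique)
    then show "(f has_integral F b - F a) {a..b}" using on[of "{a..b}"] by (simp add: integrable_integral)
  qed
  have mono: "mono F"
    unfolding F_def by (intro monoI integral_subset_le) (auto intro: on nonneg)
  have bound: "F y - F x \<le> integral\<^sup>L lborel f" for x y
  proof (cases "x \<le> y")
    case True
    then have "F y - F x = integral {x..y} f" using p unfolding primitive_def by (metis integral_unique)
    also have "\<dots> \<le> integral UNIV f" by (intro integral_subset_le) (auto intro: on nonneg)
    finally show ?thesis using integral_lborel[OF int] by simp
  next
    case False
    then have "F y - F x \<le> 0" using mono by (simp add: monoD)
    also have "0 \<le> integral\<^sup>L lborel f" using nonneg by (simp add: integral_nonneg_AE)
    finally show ?thesis .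
  qed
  show ?thesis using that p mono bound by blast
qed

lemma primitive_C_class:
  assumes "C_class n f" "j < n"
  shows "primitive ((deriv ^^ Suc j) f) ((deriv ^^ j) f)"
  unfolding primitive_def
proof (intro allI impI fundamental_theorem_of_calculus)
  fix a b x :: real
  have "(deriv ^^ j) f field_differentiable at x" using assms by (simp add: C_class_def)
  then have "((deriv ^^ j) f has_real_derivative (deriv ^^ Suc j) f x) (at x)"
    by (simp add: DERIV_deriv_iff_field_differentiable)
  then show "((deriv ^^ j) f has_vector_derivative (deriv ^^ Suc j) f x) (at x within {a..b})"
    by (simp add: has_real_derivative_iff_has_vector_derivative has_vector_derivative_at_within)
qed

text \<open>A window sum that varies little over a unit interval is close to its integral over it, hence at most
  about the total mass.\<close>

lemma periodization_finite:
  assumes p: "primitive f F" and F: "\<And>x y. F y - F x \<le> c" and nonneg: "\<And>x. 0 \<le> f x"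
    and am: "asymptotic_modulus f (\<lambda>d. d * (1 - d) * C)" and "0 \<le> C"
  shows "periodization f x < \<infinity>"
proof -
  obtain N0 where N0: "\<And>N d. N0 \<le> N \<Longrightarrow> 0 \<le> d \<Longrightarrow> d \<le> 1 \<Longrightarrow>
     \<bar>window_sum f N (x + d) - window_sum f N x\<bar> \<le> d * (1 - d) * C + 1"
    using am unfolding asymptotic_modulus_def by (meson order_refl zero_less_one)
  have "window_sum f N x \<le> c + C + 1" if "N0 \<le> N" for N
  proof -
    have i: "(window_sum f N has_integral window_sum F N (x + 1) - window_sum F N x) {x..x+1}"
      using primitive_window_sum[OF p] by (simp add: primitive_def)
    have "window_sum f N x - (C + 1) \<le> window_sum f N y" if y: "y \<in> {x..x+1}" for y
    proof -
      have "(y - x) * (1 - (y - x)) * C \<le> 1 * C"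
        using y \<open>0 \<le> C\<close> by (intro mult_right_mono mult_le_one) auto
      then show ?thesis using N0[OF \<open>N0 \<le> N\<close>, of "y - x"] y by auto
    qed
    then have "window_sum f N x - (C + 1) \<le> window_sum F N (x + 1) - window_sum F N x"
      using has_integral_le[OF has_integral_const_real[of "window_sum f N x - (C + 1)" x "x + 1"] i] by simp
    \<comment> \<open>By telescoping, the integral of the window sum is the mass of \<open>f\<close>
      between x - N and x + 1 + N.\<close>
    also have "\<dots> \<le> c" unfolding window_sum_unit_step by (rule F)
    finally show ?thesis by simp
  qed
  then have "periodization f x \<le> ennreal (c + C + 1)"
    by (intro LIMSEQ_le_const2[OF window_sum_tendsto_periodization[OF nonneg]]) (blast intro: ennreal_leI)
  also have "\<dots> < \<infinity>" by simp
  finally show ?thesis .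
qed

text \<open>Finiteness turns convergence in \<open>ennreal\<close> into convergence of real numbers.
  The window bound passes to the limit in \<open>N\<close> for fixed \<open>e\<close>, and then
  \<open>e\<close> tends to 0.\<close>

lemma periodization_increment_bound:
  assumes nonneg: "\<And>x. 0 \<le> f x" and fin: "\<And>x. periodization f x < \<infinity>"
    and am: "asymptotic_modulus f c" and "0 \<le> d" "d \<le> 1"
  shows "\<bar>enn2real (periodization f (x + d)) - enn2real (periodization f x)\<bar> \<le> c d"
proof (rule field_le_epsilon)
  fix e :: real assume "e > 0"
  have lim: "(\<lambda>N. window_sum f N x) \<longlonglongrightarrow> enn2real (periodization f x)" for x
  proof -
    have "(\<lambda>N. ennreal (window_sum f N x)) \<longlonglongrightarrow> ennreal (enn2real (periodization f x))"
      using window_sum_tendsto_periodization[OF nonneg, where x=x] fin[of x] by simp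
    moreover have "0 \<le> window_sum f N x" for N
      unfolding window_sum_def using nonneg by (intro sum_nonneg) simp
    ultimately show ?thesis using tendsto_enn2real by fastforce
  qed
  obtain N0 where "\<And>N. N0 \<le> N \<Longrightarrow> \<bar>window_sum f N (x + d) - window_sum f N x\<bar> \<le> c d + e"
    using am \<open>e > 0\<close> assms(4,5) unfolding asymptotic_modulus_def by (meson order_refl)
  then show "\<bar>enn2real (periodization f (x + d)) - enn2real (periodization f x)\<bar> \<le> c d + e"
    by (intro LIMSEQ_le_const2[OF tendsto_rabs[OF tendsto_diff[OF lim lim]]]) blast
qed

section \<open>Lipschitz continuity and the sharp increment bound\<close>

lemma lipschitz_of_unit_increments:
  fixes h :: "real \<Rightarrow> real"
  assumes h: "\<And>x d. 0 \<le> d \<Longrightarrow> d \<le> 1 \<Longrightarrow> \<bar>h (x + d) - h x\<bar> \<le> d * C" and "0 \<le> C"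
  shows "C-lipschitz_on UNIV h"
proof -
  have step: "\<bar>h (x + real n * d) - h x\<bar> \<le> real n * d * C" if "0 \<le> d" "d \<le> 1" for x d n
  proof (induction n)
    case (Suc n)
    have "\<bar>h (x + real n * d + d) - h (x + real n * d)\<bar> \<le> d * C" using that by (rule h)
    moreover have "x + real (Suc n) * d = x + real n * d + d" by (simp add: algebra_simps)
    moreover have "real (Suc n) * d * C = real n * d * C + d * C" by (simp add: algebra_simps)
    ultimately show ?case using Suc.IH by (simp only: abs_le_iff) linarith
  qed simp
  have le: "\<bar>h y - h x\<bar> \<le> (y - x) * C" if "x \<le> y" for x y
  proof -
    \<comment> \<open>Cutting [x, y] into \<open>n\<close> equal pieces makes each of them shorter
      than 1.\<close>
    obtain n :: nat where n: "y - x < real n" using reals_Archimedean2 by blast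
    then have "0 < real n" using that by linarith
    then show ?thesis using step[of "(y - x) / real n" x n] n that by simp
  qed
  show ?thesis
  proof (rule lipschitz_onI)
    fix x y :: real
    show "dist (h x) (h y) \<le> C * dist x y"
      using le[of x y] le[of y x] by (cases "x \<le> y") (auto simp: dist_real_def abs_minus_commute mult.commute)
  qed fact
qed

theorem theorem3:
  fixes M :: "'a measure" and Y :: "'a \<Rightarrow> real" and f fk :: "real \<Rightarrow> real" and k :: nat
  assumes "prob_space M"
    and "\<forall>x. 0 \<le> f x"
    and "distributed M lborel Y (\<lambda>x. ennreal (f x))"
    and "1 \<le> k"
    and "times_abs_continuous k f"
    and "deriv_version k f fk"
    and "total_variation fk < \<infinity>"
  defines "g \<equiv> periodization f"
    and "TV \<equiv> enn2real (total_variation fk)"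
  shows "(\<forall>x. g x < \<infinity>) \<and>
    (\<exists>L. L-lipschitz_on UNIV (\<lambda>x. enn2real (g x))) \<and>
    (\<forall>x y. \<bar>x - y\<bar> \<le> 1 \<longrightarrow>
      \<bar>enn2real (g x) - enn2real (g y)\<bar> \<le> \<bar>x - y\<bar> * (1 - \<bar>x - y\<bar>) * (TV / (2 * 6 ^ (k - 1))) \<and>
      \<bar>x - y\<bar> * (1 - \<bar>x - y\<bar>) * (TV / (2 * 6 ^ (k - 1))) \<le> TV / (8 * 6 ^ (k - 1)))"
proof -
  define C where "C = TV / (2 * 6 ^ (k - 1))"
  have "0 \<le> C" by (simp add: C_def TV_def)
  have nonneg: "0 \<le> f x" for x using assms(2) by simp
  have meas: "f \<in> borel_measurable lborel" using distributed_real_measurable[OF _ assms(3)] nonneg by simp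
  have nn: "(\<integral>\<^sup>+x. ennreal (f x) \<partial>lborel) = 1"
    using distributed_nn_integral[OF assms(3), of "\<lambda>_. 1"] prob_space.emeasure_space_1[OF assms(1)] by simp
  have int: "integrable lborel f"
    using meas nn nonneg by (intro integrableI_nonneg) auto
  obtain F where F: "primitive f F" "mono F" "\<And>x y. F y - F x \<le> integral\<^sup>L lborel f"
    using integrable_lborel_has_primitive[OF int nonneg] by blast
  have cls: "C_class (k - 1) f" and ac: "locally_abs_continuous ((deriv ^^ (k - 1)) f)"
    using assms(5) by (auto simp: times_abs_continuous_def)
  have top: "primitive fk ((deriv ^^ (k - 1)) f)"
    unfolding primitive_def
    using has_integral_deriv_AE_abs_continuous ac assms(6)
    by (simp add: locally_abs_continuous_def deriv_version_def)
  \<comment> \<open>The index is one ahead of the order of the derivative: the distribution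
    function, \<open>f\<close>, its derivatives up to order k - 1, and the given version
    \<open>fk\<close> on top.\<close>
  define G where "G i = (if i = 0 then F else if i \<le> k then (deriv ^^ (i - 1)) f else fk)" for i
  have G: "G (Suc k) = fk" "G 1 = f" using \<open>1 \<le> k\<close> by (auto simp: G_def)
  have chain: "primitive (G (Suc i)) (G i)" if i: "i < Suc k" for i
  proof -
    consider "i = 0" | j where "i = Suc j" "j < k - 1" | "i = Suc (k - 1)"
      using i \<open>1 \<le> k\<close> by (cases i) force+
    then show ?thesis
    proof cases
      case 2
      then have "Suc (Suc j) \<le> k" by linarith
      with 2 show ?thesis using primitive_C_class[OF cls, of j] by (simp add: G_def)
    qed (use F(1) top \<open>1 \<le> k\<close> in \<open>auto simp: G_def\<close>)
  qed
  have "slowly_oscillating (G 0)"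
    using total_variation_mono_bounded[OF F(2,3)]
    by (intro finite_total_variation_imp_slowly_oscillating) (auto simp: G_def intro: le_less_trans)
  moreover have "slowly_oscillating (G (Suc k))"
    using finite_total_variation_imp_slowly_oscillating[OF assms(7)] G by simp
  ultimately have van: "vanishing (G i)" if "1 \<le> i" "i \<le> Suc k" for i
    using vanishing_primitive_chain[of "Suc k" G i] chain that by blast
  \<comment> \<open>Going from \<open>G k\<close> down to \<open>G 1 = f\<close> takes
    \<open>k - 1\<close> integrations, hence the power of 6.\<close>
  have am: "asymptotic_modulus f (\<lambda>d. d * (1 - d) * C)"
    using asymptotic_modulus_primitive_chain[of k G "k - 1", OF chain van] assms(4,7) G
    by (simp add: C_def TV_def)
  have fin: "g x < \<infinity>" for x
    unfolding g_def by (rule periodization_finite[OF F(1,3) nonneg am \<open>0 \<le> C\<close>])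
  have inc: "\<bar>enn2real (g (x + d)) - enn2real (g x)\<bar> \<le> d * (1 - d) * C" if "0 \<le> d" "d \<le> 1" for x d
    unfolding g_def by (rule periodization_increment_bound[OF nonneg fin[unfolded g_def] am that])
  have "C-lipschitz_on UNIV (\<lambda>x. enn2real (g x))"
  proof (rule lipschitz_of_unit_increments[OF _ \<open>0 \<le> C\<close>])
    fix x d :: real assume d: "0 \<le> d" "d \<le> 1"
    then have "d * (1 - d) * C \<le> d * C"
      using \<open>0 \<le> C\<close> by (intro mult_right_mono) (auto simp: mult_left_le)
    then show "\<bar>enn2real (g (x + d)) - enn2real (g x)\<bar> \<le> d * C" using inc[OF d, of x] by linarith
  qed
  moreover have "\<bar>enn2real (g x) - enn2real (g y)\<bar> \<le> \<bar>x - y\<bar> * (1 - \<bar>x - y\<bar>) * C" if "\<bar>x - y\<bar> \<le> 1" for x y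
    using inc[of "y - x" x] inc[of "x - y" y] that by (cases "x \<le> y") (auto simp: abs_minus_commute)
  moreover have "d * (1 - d) * C \<le> TV / (8 * 6 ^ (k - 1))" for d :: real
  proof -
    \<comment> \<open>The maximum of d (1 - d) is 1/4, attained at 1/2; it turns the factor 2 in the
      denominator of \<open>C\<close> into 8.\<close>
    have "0 \<le> (d - 1 / 2)\<^sup>2" by simp
    then have "d * (1 - d) \<le> 1 / 4" by (simp add: power2_eq_square algebra_simps)
    then have "d * (1 - d) * C \<le> 1 / 4 * C" using \<open>0 \<le> C\<close> by (rule mult_right_mono)
    then show ?thesis by (simp add: C_def)
  qed
  ultimately show ?thesis using fin unfolding C_def by blast
qed

end
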